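(* Let $\mathcal{R}$ and $\mathcal{R}'$ be two recommendations for $K$ taxicabs (in the sense of the context) which differ only in their $q$-th route: the $q$-th route of $\mathcal{R}$ is $(c_1,\dots,c_{l-1})$ and the $q$-th route of $\mathcal{R}'$ is $(c_1,\dots,c_{l})$ for some $l\ge 1$, all other routes being identical; write $c_0=0$. Let $t_{\mathrm{end}}$ be the arrival time of taxicab $q$ at $c_l$ under $\mathcal{R}'$, and assume that for every $k\neq q$ and every index $u$ with $c_{k,u}=c_l$ one has $t_{k,u}<t_{\mathrm{end}}$, or $t_{k,u}=t_{\mathrm{end}}$ and $k<q$. Then for every outcome $\mathbf{u}=(u_1,\dots,u_K)$ of $\mathcal{R}'$, $$s_{\mathcal{R}'}(\mathbf{u})=\begin{cases} s_{\mathcal{R}}(\mathbf{u}), & 0<u_q<l,\\ s_{\mathcal{R}}(\mathbf{u})-\mathit{Penalty}+T(c_{l-1},c_l), & u_q=l,\\ s_{\mathcal{R}}(\mathbf{u}-\mathbf{i}_q)+T(c_{l-1},c_l), & u_q=l+1,\end{cases}$$ where $\mathbf{i}_q$ is the vector whose entries are all $0$ except the $q$-th, which is $1$.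
   Context: Setting. There is a set of pick-up points $\mathcal{C}=\{1,\dots,N\}$ and an initial position $0$. $T(c,c')\ge 0$ is the travel time between points $c,c'\in\mathcal{C}\cup\{0\}$, and $\mathit{Penalty}\ge 0$ is a fixed penalty time. A recommendation $\mathcal{R}=(\overrightarrow{R_1},\dots,\overrightarrow{R_K})$ is an ordered $K$-tuple of routes; route $\overrightarrow{R_k}=(c_{k,1},\dots,c_{k,l_k})$ is a sequence of $l_k\ge 0$ pairwise distinct points of $\mathcal{C}$; set $c_{k,0}=0$. All taxicabs start at $0$ at time $0$; the arrival time of taxicab $k$ at its $u$-th point is $t_{k,u}=\sum_{j=1}^{u}T(c_{k,j-1},c_{k,j})$ (so $t_{k,0}=0$). An outcome is $\mathbf{u}=(u_1,\dots,u_K)$ with $1\le u_k\le l_k+1$: taxicab $k$ picks up a passenger at its $u_k$-th point, or, if $u_k=l_k+1$, picks up nobody along its route. Total cruising time of an outcome: $s_{\mathcal{R}}(\mathbf{u})=\sum_{k=1}^K\bigl(t_{k,u_k}\,\mathbb{I}_{u_k\le l_k}+(t_{k,l_k}+\mathit{Penalty})\,\mathbb{I}_{u_k=l_k+1}\bigr)$, i.e. each taxicab contributes its travel time up to its pick-up point, or its full route travel time plus $\mathit{Penalty}$ if it picks up nobody. *)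

theory Defs
  imports Complex_Main
begin

text \<open>Pick-up points are the numbers \<open>1, \<dots>, N\<close>; the number \<open>0\<close> is the initial position.
  A \<open>K\<close>-tuple is a function on \<open>nat\<close> of which only the values on \<open>{1..K}\<close> are used.\<close>

type_synonym route = "nat list"
type_synonym recommendation = "nat \<Rightarrow> route"
type_synonym outcome = "nat \<Rightarrow> nat"

definition is_route :: "nat \<Rightarrow> route \<Rightarrow> bool" where
  "is_route N r \<longleftrightarrow> set r \<subseteq> {1..N} \<and> distinct r"

definition is_recommendation :: "nat \<Rightarrow> nat \<Rightarrow> recommendation \<Rightarrow> bool" where
  "is_recommendation N K R \<longleftrightarrow> (\<forall>k\<in>{1..K}. is_route N (R k))"

text \<open>Route positions are counted from 1, and position 0 is the initial position;
  meaningful for \<open>j \<le> length r\<close>.\<close>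

definition route_point :: "route \<Rightarrow> nat \<Rightarrow> nat" where
  "route_point r j = (0 # r) ! j"

definition arrival_time :: "(nat \<Rightarrow> nat \<Rightarrow> real) \<Rightarrow> route \<Rightarrow> nat \<Rightarrow> real" where
  "arrival_time T r u = (\<Sum>j=1..u. T (route_point r (j - 1)) (route_point r j))"

definition is_outcome :: "nat \<Rightarrow> recommendation \<Rightarrow> outcome \<Rightarrow> bool" where
  "is_outcome K R u \<longleftrightarrow> (\<forall>k\<in>{1..K}. 1 \<le> u k \<and> u k \<le> length (R k) + 1)"

definition total_cruising_time ::
  "(nat \<Rightarrow> nat \<Rightarrow> real) \<Rightarrow> real \<Rightarrow> nat \<Rightarrow> recommendation \<Rightarrow> outcome \<Rightarrow> real" where
  "total_cruising_time T Penalty K R u =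
     (\<Sum>k=1..K. arrival_time T (R k) (u k) * of_bool (u k \<le> length (R k))
        + (arrival_time T (R k) (length (R k)) + Penalty) * of_bool (u k = length (R k) + 1))"

definition unit_outcome :: "nat \<Rightarrow> outcome" where
  "unit_outcome q k = (if k = q then 1 else 0)"

end

theory Submission
  imports Defs
begin

text \<open>The total is a sum of separate contributions \<open>cruising_time\<close>, one per
  taxicab, so between \<open>R\<close> and \<open>R'\<close> only the contribution of taxicab
  \<open>q\<close> can change (\<open>total_cruising_time_diff\<close>). On a route read off from
  \<open>c\<close>, that contribution is a partial sum of leg times, plus \<open>Penalty\<close> if
  nobody is picked up (\<open>cruising_time_map_upt\<close>). Both routes of taxicab
  \<open>q\<close> read off the same \<open>c\<close>, so their partial sums agree and the full ones
  differ by the last leg \<open>T (c (l - 1)) (c l)\<close>. Comparing the two contributions in each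
  case gives the formula.\<close>

definition cruising_time :: "(nat \<Rightarrow> nat \<Rightarrow> real) \<Rightarrow> real \<Rightarrow> route \<Rightarrow> nat \<Rightarrow> real" where
  "cruising_time T Penalty r v =
     arrival_time T r v * of_bool (v \<le> length r)
       + (arrival_time T r (length r) + Penalty) * of_bool (v = length r + 1)"

lemma total_cruising_time_eq_sum:
  "total_cruising_time T Penalty K R u = (\<Sum>k=1..K. cruising_time T Penalty (R k) (u k))"
  by (simp add: total_cruising_time_def cruising_time_def)

text \<open>The summands of all other taxicabs cancel. The outcomes may differ at \<open>q\<close>
  as well, so that the lemma also serves the comparison with the shifted outcome.\<close>

lemma total_cruising_time_diff:
  assumes "q \<in> {1..K}"
    and "\<And>k. k \<in> {1..K} \<Longrightarrow> k \<noteq> q \<Longrightarrow> R' k = R k \<and> u' k = u k"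
  shows "total_cruising_time T Penalty K R' u' - total_cruising_time T Penalty K R u =
    cruising_time T Penalty (R' q) (u' q) - cruising_time T Penalty (R q) (u q)"
proof -
  have "(\<Sum>k\<in>{1..K} - {q}. cruising_time T Penalty (R' k) (u' k)) =
      (\<Sum>k\<in>{1..K} - {q}. cruising_time T Penalty (R k) (u k))"
    using assms(2) by (intro sum.cong) auto
  then show ?thesis
    using assms(1) by (simp add: total_cruising_time_eq_sum sum.remove[of "{1..K}" q] del: One_nat_def)
qed

text \<open>With \<open>c 0 = 0\<close> the initial position fits the indexing of \<open>c\<close>,
  so the first leg needs no separate treatment.\<close>

lemma route_point_map_upt:
  assumes "c 0 = 0" and "j < n"
  shows "route_point (map c [1..<n]) j = c j"
  using assms by (cases j) (simp_all add: route_point_def)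

lemma arrival_time_map_upt:
  assumes "c 0 = 0" and "v < n"
  shows "arrival_time T (map c [1..<n]) v = (\<Sum>j=1..v. T (c (j - 1)) (c j))"
  unfolding arrival_time_def
  using assms by (intro sum.cong) (auto simp: route_point_map_upt simp del: One_nat_def)

text \<open>The route has \<open>n - 1\<close> points, so \<open>v = n\<close> is exactly the value
  that encodes no pick-up.\<close>

lemma cruising_time_map_upt:
  assumes "c 0 = 0" and "1 \<le> n" and "v \<le> n"
  shows "cruising_time T Penalty (map c [1..<n]) v =
    (if v < n then \<Sum>j=1..v. T (c (j - 1)) (c j)
     else (\<Sum>j=1..n - 1. T (c (j - 1)) (c j)) + Penalty)"
proof (cases "v < n")
  case True
  then have "v \<le> n - 1" "v \<noteq> n - 1 + 1" by auto
  with True assms(1) show ?thesis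
    by (simp add: cruising_time_def arrival_time_map_upt del: One_nat_def)
next
  case False
  with assms have "v = n" "n - 1 < n" by auto
  with assms show ?thesis
    by (simp add: cruising_time_def arrival_time_map_upt del: One_nat_def)
qed

theorem theorem2:
  fixes N K q l :: nat
    and T :: "nat \<Rightarrow> nat \<Rightarrow> real"
    and Penalty t_end :: real
    and R R' :: recommendation
    and c :: "nat \<Rightarrow> nat"
    and u :: outcome
  assumes T_nonneg: "\<forall>a\<in>{0..N}. \<forall>b\<in>{0..N}. 0 \<le> T a b"
    and Penalty_nonneg: "0 \<le> Penalty"
    and rec_R: "is_recommendation N K R"
    and rec_R': "is_recommendation N K R'"
    and q: "q \<in> {1..K}"
    and l: "1 \<le> l"
    and c0: "c 0 = 0"
    and route_R: "R q = map c [1..<l]"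
    and route_R': "R' q = map c [1..<l + 1]"
    and others: "\<forall>k\<in>{1..K}. k \<noteq> q \<longrightarrow> R' k = R k"
    and t_end: "t_end = arrival_time T (R' q) l"
    and last_arrival: "\<forall>k\<in>{1..K}. k \<noteq> q \<longrightarrow>
          (\<forall>v\<in>{1..length (R k)}. route_point (R k) v = c l \<longrightarrow>
             arrival_time T (R k) v < t_end \<or> (arrival_time T (R k) v = t_end \<and> k < q))"
    and outcome: "is_outcome K R' u"
  shows "(0 < u q \<and> u q < l \<longrightarrow>
            total_cruising_time T Penalty K R' u = total_cruising_time T Penalty K R u) \<and>
         (u q = l \<longrightarrow>
            total_cruising_time T Penalty K R' u =
              total_cruising_time T Penalty K R u - Penalty + T (c (l - 1)) (c l)) \<and>
         (u q = l + 1 \<longrightarrow>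
            total_cruising_time T Penalty K R' u =
              total_cruising_time T Penalty K R (\<lambda>k. u k - unit_outcome q k) + T (c (l - 1)) (c l))"
proof -
  have time_R: "cruising_time T Penalty (R q) v =
      (if v < l then \<Sum>j=1..v. T (c (j - 1)) (c j)
       else (\<Sum>j=1..l - 1. T (c (j - 1)) (c j)) + Penalty)" if "v \<le> l" for v
    unfolding route_R using c0 l that by (rule cruising_time_map_upt)
  have time_R': "cruising_time T Penalty (R' q) v =
      (if v < l + 1 then \<Sum>j=1..v. T (c (j - 1)) (c j)
       else (\<Sum>j=1..l. T (c (j - 1)) (c j)) + Penalty)" if "v \<le> l + 1" for v
    unfolding route_R' using cruising_time_map_upt[of c "l + 1" v T Penalty] c0 that by simp
  have step: "(\<Sum>j=1..l. T (c (j - 1)) (c j)) =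
      (\<Sum>j=1..l - 1. T (c (j - 1)) (c j)) + T (c (l - 1)) (c l)"
    using l by (cases l) simp_all
  have same: "total_cruising_time T Penalty K R' u - total_cruising_time T Penalty K R u =
      cruising_time T Penalty (R' q) (u q) - cruising_time T Penalty (R q) (u q)"
    using q others by (intro total_cruising_time_diff) auto
  \<comment> \<open>The value \<open>l + 1\<close> is out of range for the shorter route, where no
    pick-up is encoded by \<open>l\<close>; hence the shift by one at \<open>q\<close>.\<close>
  have shifted: "total_cruising_time T Penalty K R' u -
        total_cruising_time T Penalty K R (\<lambda>k. u k - unit_outcome q k) =
      cruising_time T Penalty (R' q) (u q) - cruising_time T Penalty (R q) (u q - 1)"
    using total_cruising_time_diff[of q K R' R u "\<lambda>k. u k - unit_outcome q k"] q others
    by (simp add: unit_outcome_def)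
  show ?thesis
    \<comment> \<open>For \<open>u q < l\<close> the partial sums coincide. For
      \<open>u q = l\<close> the longer route pays the last leg where the shorter pays
      \<open>Penalty\<close>. For \<open>u q = l + 1\<close> both pay \<open>Penalty\<close>, and
      the last leg remains.\<close>
    using same shifted time_R[of "u q"] time_R[of "u q - 1"] time_R'[of "u q"] step
    by (auto simp del: One_nat_def)
qed

end
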